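(* Suppose $\{ t_{n} \}_{n\in\mathbb{Z}} \subset \mathbb{R}$ is a set of sampling for $PW_{2\pi}$. Then the mapping $\widetilde{\mathcal{A}} : PW_{\pi}/\!\sim\ \to \ell^{2}(\mathbb{Z}) \oplus \ell^{2}(\mathbb{Z})$, $[f] \mapsto ( | f(t_{n})|, | f^{\prime}(t_{n})|)_{n\in\mathbb{Z}}$, is one-to-one. Equivalently, if $f,g\in PW_\pi$ satisfy $|f(t_n)|=|g(t_n)|$ and $|f'(t_n)|=|g'(t_n)|$ for all $n\in\mathbb{Z}$, then there is $\lambda\in\mathbb{C}$ with $|\lambda|=1$ such that $f=\lambda g$ or $f=\lambda g^\sharp$.
   Context: For $\gamma>0$, $PW_{\gamma}$ is the space of $f \in L^2(\mathbb{R})$ whose Fourier transform $\hat f(\xi)=\int_{\mathbb{R}} f(x)e^{-ix\xi}\,dx$ vanishes a.e. outside $[-\gamma,\gamma]$; each such $f$ extends to an entire function. For entire $f$, $f^{\sharp}(z) = \overline{f(\bar z)}$. The equivalence relation $\sim$ on $PW_\pi$ is: $f\sim g$ iff $f=\lambda g$ or $f=\lambda g^\sharp$ for some $\lambda\in\mathbb{C}$ with $|\lambda|=1$; $[f]$ denotes the class of $f$. A sequence $\{t_n\}\subset\mathbb{R}$ is a set of sampling for $PW_{2\pi}$ if there are constants $A,B>0$ with $A\|f\|^2\le \sum_n |f(t_n)|^2 \le B\|f\|^2$ for all $f\in PW_{2\pi}$. *)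

theory Defs
  imports "HOL-Analysis.Analysis"
begin

text \<open>Paley-Wiener space PW_gamma, identified with the entire extensions of its
elements: f is entire and is the inverse Fourier transform of a function
F in L^2[-gamma,gamma] (with the convention hat f(xi) = int f(x) e^{-i x xi} dx,
so f(z) = (1/(2 pi)) int_{-gamma}^{gamma} F(xi) e^{i z xi} d xi).\<close>
definition PW :: "real \<Rightarrow> (complex \<Rightarrow> complex) set" where
  "PW \<gamma> = {f. f holomorphic_on UNIV \<and>
     (\<exists>F :: real \<Rightarrow> complex. F \<in> borel_measurable lborel \<and>
        set_integrable lborel {-\<gamma>..\<gamma>} (\<lambda>\<xi>. (norm (F \<xi>))\<^sup>2) \<and>
        (\<forall>z. f z = (1 / (2 * complex_of_real pi)) *
              (LINT \<xi>:{-\<gamma>..\<gamma>}|lborel. F \<xi> * exp (\<i> * z * complex_of_real \<xi>))))}"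

definition sharp :: "(complex \<Rightarrow> complex) \<Rightarrow> complex \<Rightarrow> complex" where
  "sharp f = (\<lambda>z. cnj (f (cnj z)))"

definition L2norm_sq :: "(complex \<Rightarrow> complex) \<Rightarrow> real" where
  "L2norm_sq f = (LINT x|lborel. (norm (f (complex_of_real x)))\<^sup>2)"

definition sampling_set :: "(int \<Rightarrow> real) \<Rightarrow> real \<Rightarrow> bool" where
  "sampling_set t \<gamma> \<longleftrightarrow> (\<exists>A B. A > 0 \<and> B > 0 \<and> (\<forall>f \<in> PW \<gamma>.
      (\<lambda>n. (norm (f (complex_of_real (t n))))\<^sup>2) summable_on UNIV \<and>
      A * L2norm_sq f \<le> (\<Sum>\<^sub>\<infinity>n. (norm (f (complex_of_real (t n))))\<^sup>2) \<and>
      (\<Sum>\<^sub>\<infinity>n. (norm (f (complex_of_real (t n))))\<^sup>2) \<le> B * L2norm_sq f))"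

end

theory Submission
  imports Defs "HOL-Complex_Analysis.Complex_Analysis" "HOL-Probability.Probability"
begin

text \<open>
  For \<open>f, g \<in> PW \<pi>\<close> the functions \<open>f f\<^sup>\<sharp> - g g\<^sup>\<sharp>\<close> and \<open>f' f'\<^sup>\<sharp> - g' g'\<^sup>\<sharp>\<close> lie in \<open>PW (2\<pi>)\<close>, since
  a product has the convolution of the two spectra as its spectrum. On the real line they equal
  \<open>|f|\<^sup>2 - |g|\<^sup>2\<close> and \<open>|f'|\<^sup>2 - |g'|\<^sup>2\<close>, so they vanish on the sampling set and hence identically.
  Differentiating \<open>f f\<^sup>\<sharp> = g g\<^sup>\<sharp>\<close> shows that the pairs \<open>(f' f\<^sup>\<sharp>, f f\<^sup>\<sharp>')\<close> and \<open>(g' g\<^sup>\<sharp>, g g\<^sup>\<sharp>')\<close> have the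
  same sum and the same product, and entire functions have no zero divisors, so \<open>f' f\<^sup>\<sharp>\<close> is one of
  \<open>g' g\<^sup>\<sharp>\<close> and \<open>g g\<^sup>\<sharp>'\<close>. Accordingly the Wronskian of \<open>f\<close> with \<open>g\<close>, or with \<open>g\<^sup>\<sharp>\<close>, vanishes.
\<close>

section \<open>Band-limited spectra and the inverse Fourier integral\<close>

text \<open>Spectra live on the whole line and vanish at every point outside the band, so
  reflections, translations and convolutions need no set integrals.\<close>

definition band_limited :: "real \<Rightarrow> (real \<Rightarrow> complex) \<Rightarrow> bool" where
  "band_limited \<gamma> F \<longleftrightarrow> F \<in> borel_measurable lborel \<and>
     integrable lborel (\<lambda>\<xi>. (norm (F \<xi>))\<^sup>2) \<and> (\<forall>\<xi>. \<gamma> < \<bar>\<xi>\<bar> \<longrightarrow> F \<xi> = 0)"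

text \<open>The factor 1/(2 pi) is left to the spectrum; this way convolution corresponds to the
  product without a constant.\<close>

definition inv_fourier :: "(real \<Rightarrow> complex) \<Rightarrow> complex \<Rightarrow> complex" where
  "inv_fourier F z = (LINT \<xi>|lborel. F \<xi> * exp (\<i> * z * complex_of_real \<xi>))"

lemma norm_sum_sq_le:
  fixes a b :: "'a::real_normed_vector"
  shows "(norm (a + b))\<^sup>2 \<le> 2 * (norm a)\<^sup>2 + 2 * (norm b)\<^sup>2"
proof -
  have "(norm (a + b))\<^sup>2 \<le> (norm a + norm b)\<^sup>2"
    by (intro power_mono norm_triangle_ineq) auto
  also have "\<dots> \<le> 2 * (norm a)\<^sup>2 + 2 * (norm b)\<^sup>2"
    using sum_squares_bound[of "norm a" "norm b"] by (simp add: power2_sum)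
  finally show ?thesis .
qed

lemma borel_measurable_cnj [measurable (raw)]:
  "f \<in> borel_measurable M \<Longrightarrow> (\<lambda>x. cnj (f x)) \<in> borel_measurable M"
  by (rule borel_measurable_continuous_on[OF continuous_on_cnj[OF continuous_on_id]])

text \<open>The sign of \<gamma> is not fixed: for negative \<gamma> the spectrum is zero
  everywhere. Bounds by the absolute value of \<gamma> cover both signs.\<close>

lemma band_limited_support: "band_limited \<gamma> F \<Longrightarrow> F \<xi> = 0 \<or> \<bar>\<xi>\<bar> \<le> \<bar>\<gamma>\<bar>"
  by (force simp: band_limited_def)

lemma band_limited_measurable [measurable_dest]:
  "band_limited \<gamma> F \<Longrightarrow> F \<in> borel_measurable borel"
  by (simp add: band_limited_def)

text \<open>An L^2 function on a bounded set is in L^1: on the support |F| <= |F|^2 + 1, as 2x <=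
  x^2 + 1.\<close>

lemma band_limited_integrable:
  assumes F: "band_limited \<gamma> F"
  shows "integrable lborel F"
proof (rule Bochner_Integration.integrable_bound)
  have sq: "integrable lborel (\<lambda>\<xi>. (norm (F \<xi>))\<^sup>2)"
    using F by (simp add: band_limited_def)
  have ind: "integrable lborel (indicator {-\<bar>\<gamma>\<bar>..\<bar>\<gamma>\<bar>} :: real \<Rightarrow> real)"
    by (intro integrable_real_indicator) auto
  show "integrable lborel (\<lambda>\<xi>. (norm (F \<xi>))\<^sup>2 + indicator {-\<bar>\<gamma>\<bar>..\<bar>\<gamma>\<bar>} \<xi>)"
    by (rule Bochner_Integration.integrable_add[OF sq ind])
  show "F \<in> borel_measurable lborel"
    using F by (simp add: band_limited_def)
  have "norm (F \<xi>) \<le> norm ((norm (F \<xi>))\<^sup>2 + indicator {-\<bar>\<gamma>\<bar>..\<bar>\<gamma>\<bar>} \<xi>)" for \<xi>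
  proof (cases "F \<xi> = 0")
    case False
    then have "\<bar>\<xi>\<bar> \<le> \<bar>\<gamma>\<bar>"
      using band_limited_support[OF F, of \<xi>] by blast
    then have "indicator {-\<bar>\<gamma>\<bar>..\<bar>\<gamma>\<bar>} \<xi> = (1::real)"
      by (auto simp: indicator_def)
    moreover have "norm (F \<xi>) \<le> (norm (F \<xi>))\<^sup>2 + 1"
      using sum_squares_bound[of "norm (F \<xi>)" 1] norm_ge_zero[of "F \<xi>"] by (simp del: norm_ge_zero)
    ultimately show ?thesis by simp
  qed simp
  then show "AE \<xi> in lborel. norm (F \<xi>) \<le> norm ((norm (F \<xi>))\<^sup>2 + indicator {-\<bar>\<gamma>\<bar>..\<bar>\<gamma>\<bar>} \<xi>)"
    by simp
qed

lemma norm_exp_ii_le: "norm (exp (\<i> * z * complex_of_real \<xi>)) \<le> exp (norm z * \<bar>\<xi>\<bar>)"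
  using norm_exp[of "\<i> * z * complex_of_real \<xi>"] by (simp add: norm_mult)

lemma band_limited_norm_mult_exp_le:
  assumes F: "band_limited \<gamma> F"
  shows "norm (F \<xi> * exp (\<i> * z * complex_of_real \<xi>)) \<le> exp (norm z * \<bar>\<gamma>\<bar>) * norm (F \<xi>)"
proof (cases "F \<xi> = 0")
  case False
  then have "\<bar>\<xi>\<bar> \<le> \<bar>\<gamma>\<bar>"
    using band_limited_support[OF F, of \<xi>] by blast
  then have "exp (norm z * \<bar>\<xi>\<bar>) \<le> exp (norm z * \<bar>\<gamma>\<bar>)"
    by (simp add: mult_left_mono)
  then have "norm (exp (\<i> * z * complex_of_real \<xi>)) \<le> exp (norm z * \<bar>\<gamma>\<bar>)"
    using norm_exp_ii_le order_trans by blast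
  then show ?thesis
    by (simp only: norm_mult) (metis mult.commute mult_left_mono norm_ge_zero)
qed simp

lemma band_limited_integrable_exp:
  assumes F: "band_limited \<gamma> F"
  shows "integrable lborel (\<lambda>\<xi>. F \<xi> * exp (\<i> * z * complex_of_real \<xi>))"
proof (rule Bochner_Integration.integrable_bound)
  note [measurable] = band_limited_measurable[OF F]
  show "integrable lborel (\<lambda>\<xi>. exp (norm z * \<bar>\<gamma>\<bar>) * norm (F \<xi>))"
    using band_limited_integrable[OF F] by simp
  show "(\<lambda>\<xi>. F \<xi> * exp (\<i> * z * complex_of_real \<xi>)) \<in> borel_measurable lborel"
    by measurable
  show "AE \<xi> in lborel. norm (F \<xi> * exp (\<i> * z * complex_of_real \<xi>))
      \<le> norm (exp (norm z * \<bar>\<gamma>\<bar>) * norm (F \<xi>))"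
    using band_limited_norm_mult_exp_le[OF F, of _ z] by simp
qed

text \<open>This multiplier is differentiation on the spectral side. It is bounded on the support,
  so neither square integrability nor the band is lost.\<close>

lemma band_limited_mult_ident:
  assumes F: "band_limited \<gamma> F"
  shows "band_limited \<gamma> (\<lambda>\<xi>. \<i> * complex_of_real \<xi> * F \<xi>)"
proof -
  note [measurable] = band_limited_measurable[OF F]
  have "integrable lborel (\<lambda>\<xi>. (norm (\<i> * complex_of_real \<xi> * F \<xi>))\<^sup>2)"
  proof (rule Bochner_Integration.integrable_bound)
    show "integrable lborel (\<lambda>\<xi>. \<gamma>\<^sup>2 * (norm (F \<xi>))\<^sup>2)"
      using F by (simp add: band_limited_def)
    have "(norm (\<i> * complex_of_real \<xi> * F \<xi>))\<^sup>2 \<le> \<gamma>\<^sup>2 * (norm (F \<xi>))\<^sup>2" for \<xi>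
      using band_limited_support[OF F, of \<xi>]
      by (cases "F \<xi> = 0")
        (auto simp: norm_mult power_mult_distrib abs_le_square_iff intro!: mult_right_mono)
    then show "AE \<xi> in lborel. norm ((norm (\<i> * complex_of_real \<xi> * F \<xi>))\<^sup>2)
        \<le> norm (\<gamma>\<^sup>2 * (norm (F \<xi>))\<^sup>2)"
      by simp
  qed measurable
  moreover have "(\<lambda>\<xi>. \<i> * complex_of_real \<xi> * F \<xi>) \<in> borel_measurable lborel"
    by measurable
  ultimately show ?thesis
    using F by (auto simp: band_limited_def)
qed

text \<open>Differentiation under the integral, by an explicit remainder: the integrand's
  first-order error is O(|h|^2) times |F|, and |F| is integrable.\<close>

lemma inv_fourier_has_field_derivative:
  assumes F: "band_limited \<gamma> F"
  shows "(inv_fourier F has_field_derivative inv_fourier (\<lambda>\<xi>. \<i> * complex_of_real \<xi> * F \<xi>) z) (at z)"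
proof -
  note [measurable] = band_limited_measurable[OF F]
  let ?G = "\<lambda>\<xi>. \<i> * complex_of_real \<xi> * F \<xi>"
  let ?e = "\<lambda>z \<xi>. exp (\<i> * z * complex_of_real \<xi>)"
  have int: "integrable lborel (\<lambda>\<xi>. F \<xi> * ?e w \<xi>)" for w
    by (rule band_limited_integrable_exp[OF F])
  have intG: "integrable lborel (\<lambda>\<xi>. ?G \<xi> * ?e z \<xi>)"
    by (rule band_limited_integrable_exp[OF band_limited_mult_ident[OF F]])
  \<comment> \<open>The three factors bound, on the support, the exponential at \<open>z\<close>,
    the factor exp |w| when |h| <= 1, and |w|^2 / |h|^2, where w = i h xi.\<close>
  define C where "C = exp (norm z * \<bar>\<gamma>\<bar>) * exp \<bar>\<gamma>\<bar> * \<gamma>\<^sup>2"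
  define D where "D = (LINT \<xi>|lborel. C * norm (F \<xi>))"
  have rem: "norm (inv_fourier F (z + h) - inv_fourier F z - h * inv_fourier ?G z) \<le> (norm h)\<^sup>2 * D"
    if h: "norm h \<le> 1" for h
  proof -
    have "inv_fourier F (z + h) - inv_fourier F z - h * inv_fourier ?G z =
        (LINT \<xi>|lborel. F \<xi> * ?e (z + h) \<xi> - F \<xi> * ?e z \<xi> - h * (?G \<xi> * ?e z \<xi>))"
      unfolding inv_fourier_def using int intG by simp
    moreover have "norm (F \<xi> * ?e (z + h) \<xi> - F \<xi> * ?e z \<xi> - h * (?G \<xi> * ?e z \<xi>))
        \<le> (norm h)\<^sup>2 * (C * norm (F \<xi>))" for \<xi>
    proof (cases "F \<xi> = 0")
      case False
      then have \<xi>: "\<bar>\<xi>\<bar> \<le> \<bar>\<gamma>\<bar>"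
        using band_limited_support[OF F, of \<xi>] by blast
      define w where "w = \<i> * h * complex_of_real \<xi>"
      have nw: "norm w = norm h * \<bar>\<xi>\<bar>"
        by (simp add: w_def norm_mult)
      have "norm w \<le> 1 * \<bar>\<gamma>\<bar>"
        unfolding nw using h \<xi> by (intro mult_mono) auto
      then have e: "exp (norm w) \<le> exp \<bar>\<gamma>\<bar>" by simp
      have "norm w \<le> norm h * \<bar>\<gamma>\<bar>"
        unfolding nw using \<xi> by (intro mult_left_mono) auto
      then have "(norm w)\<^sup>2 \<le> (norm h * \<bar>\<gamma>\<bar>)\<^sup>2"
        by (intro power_mono) auto
      then have sq: "(norm w)\<^sup>2 \<le> (norm h)\<^sup>2 * \<gamma>\<^sup>2"
        by (simp add: power_mult_distrib)
      have "norm (exp w - 1 - w) \<le> exp (norm w) * (norm w)\<^sup>2"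
        using Taylor_exp_field[of w 1] by (simp add: numeral_2_eq_2 algebra_simps)
      also have "\<dots> \<le> exp \<bar>\<gamma>\<bar> * ((norm h)\<^sup>2 * \<gamma>\<^sup>2)"
        using e sq by (intro mult_mono) auto
      finally have t: "norm (exp w - 1 - w) \<le> exp \<bar>\<gamma>\<bar> * ((norm h)\<^sup>2 * \<gamma>\<^sup>2)" .
      have "?e (z + h) \<xi> = ?e z \<xi> * exp w"
        by (simp add: w_def exp_add[symmetric] algebra_simps)
      then have "F \<xi> * ?e (z + h) \<xi> - F \<xi> * ?e z \<xi> - h * (?G \<xi> * ?e z \<xi>) =
          (F \<xi> * ?e z \<xi>) * (exp w - 1 - w)"
        by (simp only:) (simp add: w_def algebra_simps)
      also have "norm \<dots> \<le> (exp (norm z * \<bar>\<gamma>\<bar>) * norm (F \<xi>)) * (exp \<bar>\<gamma>\<bar> * ((norm h)\<^sup>2 * \<gamma>\<^sup>2))"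
        unfolding norm_mult[of "F \<xi> * ?e z \<xi>"]
        by (intro mult_mono t band_limited_norm_mult_exp_le[OF F]) auto
      finally show ?thesis
        by (simp add: C_def mult_ac)
    qed simp
    ultimately have "norm (inv_fourier F (z + h) - inv_fourier F z - h * inv_fourier ?G z)
        \<le> (LINT \<xi>|lborel. (norm h)\<^sup>2 * (C * norm (F \<xi>)))"
      using band_limited_integrable[OF F] int intG
      by (simp only:) (intro Bochner_Integration.integral_norm_bound_integral, auto)
    then show ?thesis by (simp add: D_def)
  qed
  have "((\<lambda>h. (inv_fourier F (z + h) - inv_fourier F z) / h - inv_fourier ?G z) \<longlongrightarrow> 0) (at 0)"
  proof (rule Lim_null_comparison)
    show "((\<lambda>h::complex. norm h * D) \<longlongrightarrow> 0) (at 0)"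
      by (intro tendsto_mult_left_zero tendsto_norm_zero tendsto_ident_at)
    have "norm ((inv_fourier F (z + h) - inv_fourier F z) / h - inv_fourier ?G z) \<le> norm h * D"
      if "h \<noteq> 0" "dist h 0 < 1" for h
    proof -
      have "(inv_fourier F (z + h) - inv_fourier F z) / h - inv_fourier ?G z =
          (inv_fourier F (z + h) - inv_fourier F z - h * inv_fourier ?G z) / h"
        using that by (simp add: field_simps)
      then show ?thesis
        using rem[of h] that by (simp add: norm_divide divide_simps power2_eq_square mult_ac)
    qed
    then show "\<forall>\<^sub>F h in at 0. norm ((inv_fourier F (z + h) - inv_fourier F z) / h - inv_fourier ?G z)
        \<le> norm h * D"
      unfolding eventually_at by (intro exI[of _ 1]) auto
  qed
  then show ?thesis
    unfolding DERIV_def by (simp add: LIM_zero_iff)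
qed

lemma inv_fourier_holomorphic:
  assumes "band_limited \<gamma> F"
  shows "inv_fourier F holomorphic_on UNIV"
  using inv_fourier_has_field_derivative[OF assms] by (auto simp: holomorphic_on_open)

section \<open>Paley-Wiener spaces and their closure properties\<close>

text \<open>Truncating the spectrum to the band and moving 1/(2 pi) into it trades the set integral
  for an integral over the line; multiplying by 2 pi goes back.\<close>

lemma PW_iff:
  "f \<in> PW \<gamma> \<longleftrightarrow> (\<exists>F. band_limited \<gamma> F \<and> f = inv_fourier F)"
proof
  assume f: "f \<in> PW \<gamma>"
  then obtain F where F [measurable]: "F \<in> borel_measurable lborel"
    and sq: "set_integrable lborel {-\<gamma>..\<gamma>} (\<lambda>\<xi>. (norm (F \<xi>))\<^sup>2)"
    and eq: "\<And>z. f z = (1 / (2 * complex_of_real pi)) *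
              (LINT \<xi>:{-\<gamma>..\<gamma>}|lborel. F \<xi> * exp (\<i> * z * complex_of_real \<xi>))"
    by (auto simp: PW_def)
  define G where "G = (\<lambda>\<xi>. (1 / (2 * complex_of_real pi)) * (indicator {-\<gamma>..\<gamma>} \<xi> *\<^sub>R F \<xi>))"
  have [measurable]: "F \<in> borel_measurable borel"
    using F by simp
  have "G \<in> borel_measurable borel"
    unfolding G_def by measurable
  moreover have "(\<lambda>\<xi>. (norm (G \<xi>))\<^sup>2) =
      (\<lambda>\<xi>. (1 / (2 * pi))\<^sup>2 * (indicator {-\<gamma>..\<gamma>} \<xi> *\<^sub>R (norm (F \<xi>))\<^sup>2))"
    by (auto simp: G_def norm_mult norm_divide power_divide indicator_def power_mult_distrib)
  then have "integrable lborel (\<lambda>\<xi>. (norm (G \<xi>))\<^sup>2)"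
    using integrable_mult_right[OF sq[unfolded set_integrable_def]] by (simp only:)
  moreover have "G \<xi> = 0" if "\<gamma> < \<bar>\<xi>\<bar>" for \<xi>
    using that by (auto simp: G_def indicator_def)
  ultimately have "band_limited \<gamma> G"
    by (simp add: band_limited_def)
  moreover have "f = inv_fourier G"
  proof
    fix z
    have "inv_fourier G z = (LINT \<xi>|lborel. (1 / (2 * complex_of_real pi)) *
         (indicator {-\<gamma>..\<gamma>} \<xi> *\<^sub>R (F \<xi> * exp (\<i> * z * complex_of_real \<xi>))))"
      unfolding inv_fourier_def G_def by (intro Bochner_Integration.integral_cong) (auto simp: mult_ac)
    also have "\<dots> = f z"
      unfolding eq set_lebesgue_integral_def by (rule integral_mult_right_zero)
    finally show "f z = inv_fourier G z" by simp
  qed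
  ultimately show "\<exists>F. band_limited \<gamma> F \<and> f = inv_fourier F" by blast
next
  assume f: "(\<exists>F. band_limited \<gamma> F \<and> f = inv_fourier F)"
  then obtain F where F: "band_limited \<gamma> F" and eq: "f = inv_fourier F" by blast
  note [measurable] = band_limited_measurable[OF F]
  have ind: "indicator {-\<gamma>..\<gamma>} \<xi> *\<^sub>R F \<xi> = F \<xi>" for \<xi>
    using F by (auto simp: band_limited_def indicator_def abs_if)
  define G where "G = (\<lambda>\<xi>. 2 * complex_of_real pi * F \<xi>)"
  have "G \<in> borel_measurable lborel"
    unfolding G_def by measurable
  moreover have "(\<lambda>\<xi>. indicator {-\<gamma>..\<gamma>} \<xi> *\<^sub>R (norm (G \<xi>))\<^sup>2) = (\<lambda>\<xi>. (2 * pi)\<^sup>2 * (norm (F \<xi>))\<^sup>2)"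
  proof
    fix \<xi>
    show "indicator {-\<gamma>..\<gamma>} \<xi> *\<^sub>R (norm (G \<xi>))\<^sup>2 = (2 * pi)\<^sup>2 * (norm (F \<xi>))\<^sup>2"
      using arg_cong[OF ind[of \<xi>], of norm]
      by (auto simp: G_def indicator_def norm_mult power_mult_distrib)
  qed
  then have "set_integrable lborel {-\<gamma>..\<gamma>} (\<lambda>\<xi>. (norm (G \<xi>))\<^sup>2)"
    using F by (simp add: set_integrable_def band_limited_def del: real_scaleR_def)
  moreover have "f z = (1 / (2 * complex_of_real pi)) *
              (LINT \<xi>:{-\<gamma>..\<gamma>}|lborel. G \<xi> * exp (\<i> * z * complex_of_real \<xi>))" for z
  proof -
    have "(LINT \<xi>:{-\<gamma>..\<gamma>}|lborel. G \<xi> * exp (\<i> * z * complex_of_real \<xi>)) =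
        (LINT \<xi>|lborel. (2 * complex_of_real pi) *
          ((indicator {-\<gamma>..\<gamma>} \<xi> *\<^sub>R F \<xi>) * exp (\<i> * z * complex_of_real \<xi>)))"
      unfolding set_lebesgue_integral_def G_def
      by (intro Bochner_Integration.integral_cong) (auto simp: mult_ac)
    also have "\<dots> = (2 * complex_of_real pi) * f z"
      unfolding ind eq inv_fourier_def by (rule integral_mult_right_zero)
    finally show ?thesis by simp
  qed
  ultimately show "f \<in> PW \<gamma>"
    using inv_fourier_holomorphic[OF F] unfolding PW_def eq by blast
qed

lemma PW_diff:
  assumes "f \<in> PW \<gamma>" "g \<in> PW \<gamma>"
  shows "(\<lambda>z. f z - g z) \<in> PW \<gamma>"
proof -
  obtain F G where F: "band_limited \<gamma> F" "f = inv_fourier F"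
    and G: "band_limited \<gamma> G" "g = inv_fourier G"
    using assms by (auto simp: PW_iff)
  note [measurable] = band_limited_measurable[OF F(1)] band_limited_measurable[OF G(1)]
  have "integrable lborel (\<lambda>\<xi>. (norm (F \<xi> - G \<xi>))\<^sup>2)"
  proof (rule Bochner_Integration.integrable_bound)
    show "integrable lborel (\<lambda>\<xi>. 2 * (norm (F \<xi>))\<^sup>2 + 2 * (norm (G \<xi>))\<^sup>2)"
      using F G by (simp add: band_limited_def)
    show "AE \<xi> in lborel. norm ((norm (F \<xi> - G \<xi>))\<^sup>2) \<le> norm (2 * (norm (F \<xi>))\<^sup>2 + 2 * (norm (G \<xi>))\<^sup>2)"
      using norm_sum_sq_le[of "F _" "- G _"] by simp
  qed measurable
  then have "band_limited \<gamma> (\<lambda>\<xi>. F \<xi> - G \<xi>)"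
    using F G by (auto simp: band_limited_def)
  moreover have "(\<lambda>z. f z - g z) = inv_fourier (\<lambda>\<xi>. F \<xi> - G \<xi>)"
    unfolding F G inv_fourier_def left_diff_distrib
    using band_limited_integrable_exp[OF F(1)] band_limited_integrable_exp[OF G(1)] by simp
  ultimately show ?thesis
    by (auto simp: PW_iff)
qed

text \<open>The conjugate of exp (i (cnj z) xi) is exp (-i z xi), so the new spectrum is the
  conjugate of the reflected one, and the band is symmetric.\<close>

lemma PW_sharp:
  assumes "f \<in> PW \<gamma>"
  shows "sharp f \<in> PW \<gamma>"
proof -
  obtain F where F: "band_limited \<gamma> F" "f = inv_fourier F"
    using assms by (auto simp: PW_iff)
  note [measurable] = band_limited_measurable[OF F(1)]
  have "integrable lborel (\<lambda>\<xi>. (norm (F (- \<xi>)))\<^sup>2)"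
    using lborel_integrable_real_affine[of "\<lambda>\<xi>. (norm (F \<xi>))\<^sup>2" "-1" 0] F by (simp add: band_limited_def)
  moreover have "(\<lambda>\<xi>. cnj (F (- \<xi>))) \<in> borel_measurable lborel"
    by (intro borel_measurable_cnj) measurable
  ultimately have "band_limited \<gamma> (\<lambda>\<xi>. cnj (F (- \<xi>)))"
    using F by (simp add: band_limited_def)
  moreover have "sharp f z = inv_fourier (\<lambda>\<xi>. cnj (F (- \<xi>))) z" for z
  proof -
    have "sharp f z = (LINT \<xi>|lborel. cnj (F \<xi>) * exp (- (\<i> * z * complex_of_real \<xi>)))"
      unfolding sharp_def F(2) inv_fourier_def
      by (rule trans[OF Bochner_Integration.integral_cnj[symmetric]], rule Bochner_Integration.integral_cong)
        (simp_all add: exp_cnj)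
    also have "\<dots> = inv_fourier (\<lambda>\<xi>. cnj (F (- \<xi>))) z"
      unfolding inv_fourier_def by (subst lborel_integral_real_affine[of "-1" _ 0]) auto
    finally show ?thesis .
  qed
  then have "sharp f = inv_fourier (\<lambda>\<xi>. cnj (F (- \<xi>)))" by blast
  ultimately show ?thesis
    by (auto simp: PW_iff)
qed

lemma PW_holomorphic: "f \<in> PW \<gamma> \<Longrightarrow> f holomorphic_on UNIV"
  by (simp add: PW_def)

lemma PW_deriv:
  assumes "f \<in> PW \<gamma>"
  shows "deriv f \<in> PW \<gamma>"
proof -
  obtain F where F: "band_limited \<gamma> F" "f = inv_fourier F"
    using assms by (auto simp: PW_iff)
  have "deriv f = inv_fourier (\<lambda>\<xi>. \<i> * complex_of_real \<xi> * F \<xi>)"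
    using DERIV_imp_deriv[OF inv_fourier_has_field_derivative[OF F(1)]] F by blast
  then show ?thesis
    using band_limited_mult_ident[OF F(1)] by (auto simp: PW_iff)
qed

section \<open>Products of functions and convolution of spectra\<close>

text \<open>By 2xy <= x^2 + y^2 the convolution of two L^2 functions is bounded, here by the sum
  \<open>M\<close> of their squared norms; a bounded function with bounded support is in L^2. The
  supports add.\<close>

lemma band_limited_convolution:
  assumes F: "band_limited a F" and G: "band_limited b G"
  shows "band_limited (a + b) (\<lambda>s. LINT \<xi>|lborel. F \<xi> * G (s - \<xi>))"
    (is "band_limited _ ?H")
proof -
  note [measurable] = band_limited_measurable[OF F] band_limited_measurable[OF G]
  have F2: "integrable lborel (\<lambda>\<xi>. (norm (F \<xi>))\<^sup>2)" and G2: "integrable lborel (\<lambda>\<xi>. (norm (G \<xi>))\<^sup>2)"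
    using F G by (simp_all add: band_limited_def)
  have [measurable]: "?H \<in> borel_measurable borel"
    by measurable
  have supp: "?H s = 0" if "a + b < \<bar>s\<bar>" for s
  proof -
    have "F \<xi> * G (s - \<xi>) = 0" for \<xi>
    proof (rule ccontr)
      assume "F \<xi> * G (s - \<xi>) \<noteq> 0"
      then have "\<bar>\<xi>\<bar> \<le> a" "\<bar>s - \<xi>\<bar> \<le> b"
        using F G by (force simp: band_limited_def)+
      then show False using that by linarith
    qed
    then show ?thesis by (simp only: Bochner_Integration.integral_zero)
  qed
  define M where "M = (LINT \<xi>|lborel. (norm (F \<xi>))\<^sup>2) + (LINT \<xi>|lborel. (norm (G \<xi>))\<^sup>2)"
  have bound: "norm (?H s) \<le> M" for s
  proof -
    have G2': "integrable lborel (\<lambda>\<xi>. (norm (G (s - \<xi>)))\<^sup>2)"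
      using lborel_integrable_real_affine[OF G2, of "-1" s] by simp
    have "norm (?H s) \<le> (LINT \<xi>|lborel. norm (F \<xi> * G (s - \<xi>)))"
      by (rule integral_norm_bound)
    also have "\<dots> \<le> (LINT \<xi>|lborel. (norm (F \<xi>))\<^sup>2 + (norm (G (s - \<xi>)))\<^sup>2)"
    proof (rule integral_mono')
      fix \<xi>
      have "2 * (norm (F \<xi>) * norm (G (s - \<xi>))) \<le> (norm (F \<xi>))\<^sup>2 + (norm (G (s - \<xi>)))\<^sup>2"
        using sum_squares_bound[of "norm (F \<xi>)" "norm (G (s - \<xi>))"] by simp
      moreover have "0 \<le> norm (F \<xi>) * norm (G (s - \<xi>))" by simp
      ultimately show "norm (F \<xi> * G (s - \<xi>)) \<le> (norm (F \<xi>))\<^sup>2 + (norm (G (s - \<xi>)))\<^sup>2"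
        unfolding norm_mult by linarith
    qed (use F2 G2' in auto)
    also have "\<dots> = M"
      unfolding M_def using F2 G2' lborel_integral_real_affine[of "-1" "\<lambda>\<xi>. (norm (G \<xi>))\<^sup>2" s]
      by simp
    finally show ?thesis .
  qed
  have "integrable lborel (\<lambda>s. (norm (?H s))\<^sup>2)"
  proof (rule Bochner_Integration.integrable_bound)
    show "integrable lborel (\<lambda>s. M\<^sup>2 * indicator {-(a + b)..a + b} s)"
      by (intro integrable_mult_right integrable_real_indicator) (auto simp: emeasure_lborel_Icc_eq)
    have "(norm (?H s))\<^sup>2 \<le> M\<^sup>2 * indicator {-(a + b)..a + b} s" for s
    proof (cases "a + b < \<bar>s\<bar>")
      case True
      then show ?thesis using supp[of s] by (simp add: indicator_def)
    next
      case False
      then have "s \<in> {-(a + b)..a + b}" by auto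
      then show ?thesis
        using power_mono[OF bound[of s], of 2] by simp
    qed
    then show "AE s in lborel. norm ((norm (?H s))\<^sup>2) \<le> norm (M\<^sup>2 * indicator {-(a + b)..a + b} s)"
      by (intro AE_I2) simp
  qed measurable
  then show ?thesis
    using supp by (simp add: band_limited_def)
qed

text \<open>The exponential at s splits into those at xi and s - xi, so each can be absorbed into
  its own factor; Fubini and translation invariance then separate the integrals.\<close>

lemma inv_fourier_convolution:
  assumes F: "band_limited a F" and G: "band_limited b G"
  shows "inv_fourier (\<lambda>s. LINT \<xi>|lborel. F \<xi> * G (s - \<xi>)) z = inv_fourier F z * inv_fourier G z"
proof -
  note [measurable] = band_limited_measurable[OF F] band_limited_measurable[OF G]
  let ?e = "\<lambda>\<xi>. exp (\<i> * z * complex_of_real \<xi>)"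
  define Fe where "Fe = (\<lambda>\<xi>. F \<xi> * ?e \<xi>)"
  define Ge where "Ge = (\<lambda>\<xi>. G \<xi> * ?e \<xi>)"
  have [measurable]: "Fe \<in> borel_measurable borel" "Ge \<in> borel_measurable borel"
    unfolding Fe_def Ge_def by measurable
  have Fi: "integrable lborel Fe" and Gi: "integrable lborel Ge"
    unfolding Fe_def Ge_def using band_limited_integrable_exp[OF F] band_limited_integrable_exp[OF G] by auto
  have Gi': "integrable lborel (\<lambda>s. Ge (s - \<xi>))" for \<xi>
    using lborel_integrable_real_affine[OF Gi, of 1 "-\<xi>"] by simp
  have norm_shift: "(LINT s|lborel. norm (Ge (s - \<xi>))) = (LINT s|lborel. norm (Ge s))" for \<xi>
    using lborel_integral_real_affine[of 1 "\<lambda>s. norm (Ge s)" "-\<xi>"] by simp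
  have shift: "(LINT s|lborel. Ge (s - \<xi>)) = (LINT s|lborel. Ge s)" for \<xi>
    using lborel_integral_real_affine[of 1 Ge "-\<xi>"] by simp
  have "integrable (lborel \<Otimes>\<^sub>M lborel) (\<lambda>(\<xi>, s). Fe \<xi> * Ge (s - \<xi>))"
  proof (rule lborel_pair.Fubini_integrable)
    show "integrable lborel (\<lambda>\<xi>. LINT s|lborel. norm (case (\<xi>, s) of (\<xi>, s) \<Rightarrow> Fe \<xi> * Ge (s - \<xi>)))"
      using Fi by (simp add: norm_mult norm_shift)
    show "AE \<xi> in lborel. integrable lborel (\<lambda>s. case (\<xi>, s) of (\<xi>, s) \<Rightarrow> Fe \<xi> * Ge (s - \<xi>))"
      using Gi' by simp
  qed measurable
  then have "(LINT s|lborel. LINT \<xi>|lborel. Fe \<xi> * Ge (s - \<xi>)) =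
      (LINT \<xi>|lborel. LINT s|lborel. Fe \<xi> * Ge (s - \<xi>))"
    by (rule lborel_pair.Fubini_integral)
  also have "\<dots> = inv_fourier F z * inv_fourier G z"
    by (simp add: shift inv_fourier_def Fe_def[symmetric] Ge_def[symmetric])
  finally have "(LINT s|lborel. LINT \<xi>|lborel. Fe \<xi> * Ge (s - \<xi>)) = inv_fourier F z * inv_fourier G z" .
  moreover have "(LINT \<xi>|lborel. F \<xi> * G (s - \<xi>)) * ?e s = (LINT \<xi>|lborel. Fe \<xi> * Ge (s - \<xi>))" for s
  proof -
    have "Fe \<xi> * Ge (s - \<xi>) = (F \<xi> * G (s - \<xi>)) * ?e s" for \<xi>
    proof -
      have "?e \<xi> * ?e (s - \<xi>) = ?e s"
        by (simp add: exp_add[symmetric] algebra_simps)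
      then show ?thesis
        unfolding Fe_def Ge_def by (metis mult.assoc mult.left_commute)
    qed
    then show ?thesis by simp
  qed
  ultimately show ?thesis
    by (simp add: inv_fourier_def)
qed

lemma PW_mult:
  assumes "f \<in> PW a" "g \<in> PW b"
  shows "(\<lambda>z. f z * g z) \<in> PW (a + b)"
proof -
  obtain F G where F: "band_limited a F" "f = inv_fourier F"
    and G: "band_limited b G" "g = inv_fourier G"
    using assms by (auto simp: PW_iff)
  have "(\<lambda>z. f z * g z) = inv_fourier (\<lambda>s. LINT \<xi>|lborel. F \<xi> * G (s - \<xi>))"
    unfolding F(2) G(2) by (intro ext inv_fourier_convolution[OF F(1) G(1), symmetric])
  then show ?thesis
    using band_limited_convolution[OF F(1) G(1)] by (auto simp: PW_iff)
qed

section \<open>Square integrability on the real line\<close>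

text \<open>The integrand is a multiple of the normal density with mean \<open>s\<close> and
  standard deviation \<open>1 / a\<close>, whose total mass is 1.\<close>

lemma nn_integral_gaussian:
  fixes a s :: real
  assumes "0 < a"
  shows "(\<integral>\<^sup>+ r. ennreal (exp (- (a * (s - r))\<^sup>2 / 2)) \<partial>lborel) = ennreal (sqrt (2 * pi) / a)"
proof -
  have eq: "exp (- (a * (s - r))\<^sup>2 / 2) = sqrt (2 * pi) / a * normal_density s (1 / a) r" for r
  proof -
    have "- (a * (s - r))\<^sup>2 / 2 = - (r - s)\<^sup>2 / (2 * (1 / a)\<^sup>2)"
      using assms by (simp add: power_mult_distrib power2_commute[of s r] power_divide)
    moreover have "sqrt (2 * pi * (1 / a)\<^sup>2) = sqrt (2 * pi) / a"
      using assms by (simp add: real_sqrt_divide real_sqrt_mult power_divide)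
    ultimately show ?thesis
      using assms by (simp add: normal_density_def)
  qed
  have "(\<integral>\<^sup>+ r. ennreal (exp (- (a * (s - r))\<^sup>2 / 2)) \<partial>lborel) =
      ennreal (LINT r|lborel. sqrt (2 * pi) / a * normal_density s (1 / a) r)"
    unfolding eq using assms by (intro nn_integral_eq_integral) auto
  also have "\<dots> = ennreal (sqrt (2 * pi) / a)"
    using assms by simp
  finally show ?thesis .
qed

text \<open>Schur's test: \<open>2 |F s| |F r| \<le> |F s|\<^sup>2 + |F r|\<^sup>2\<close> decouples the two variables.\<close>

lemma nn_integral_schur_gaussian:
  fixes F :: "real \<Rightarrow> complex" and a :: real
  assumes [measurable]: "F \<in> borel_measurable borel" and a: "0 < a"
  shows "(\<integral>\<^sup>+ (s, r). ennreal (norm (F s) * norm (F r) * exp (- (a * (s - r))\<^sup>2 / 2)) \<partial>(lborel \<Otimes>\<^sub>M lborel))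
      \<le> ennreal (sqrt (2 * pi) / a) * (\<integral>\<^sup>+ s. ennreal ((norm (F s))\<^sup>2) \<partial>lborel)"
proof -
  define k where "k = (\<lambda>s r. exp (- (a * (s - r))\<^sup>2 / 2))"
  have [measurable]: "case_prod k \<in> borel_measurable (borel \<Otimes>\<^sub>M borel)"
    unfolding k_def by measurable
  have k_sym: "k s r = k r s" for s r
    by (simp add: k_def power_mult_distrib power2_commute)
  have k_nonneg: "0 \<le> k s r" for s r
    by (simp add: k_def)
  let ?c = "ennreal (sqrt (2 * pi) / a)"
  let ?N = "\<integral>\<^sup>+ s. ennreal ((norm (F s))\<^sup>2) \<partial>lborel"
  have one: "(\<integral>\<^sup>+ s. \<integral>\<^sup>+ r. ennreal ((norm (F s))\<^sup>2 * k s r) \<partial>lborel \<partial>lborel) = ?c * ?N"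
  proof -
    have "(\<integral>\<^sup>+ r. ennreal ((norm (F s))\<^sup>2 * k s r) \<partial>lborel) = ?c * ennreal ((norm (F s))\<^sup>2)" for s
    proof -
      have "(\<integral>\<^sup>+ r. ennreal ((norm (F s))\<^sup>2 * k s r) \<partial>lborel) =
          ennreal ((norm (F s))\<^sup>2) * (\<integral>\<^sup>+ r. ennreal (k s r) \<partial>lborel)"
        by (subst nn_integral_cmult[symmetric]) (auto simp: ennreal_mult')
      also have "(\<integral>\<^sup>+ r. ennreal (k s r) \<partial>lborel) = ?c"
        unfolding k_def by (rule nn_integral_gaussian[OF a])
      finally show ?thesis by (simp add: mult.commute)
    qed
    then show ?thesis
      by (simp only:) (rule nn_integral_cmult, measurable)
  qed
  \<comment> \<open>After exchanging the order of integration, the symmetry of the kernel turns this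
    into \<open>one\<close>.\<close>
  have two: "(\<integral>\<^sup>+ s. \<integral>\<^sup>+ r. ennreal ((norm (F r))\<^sup>2 * k s r) \<partial>lborel \<partial>lborel) = ?c * ?N"
  proof -
    have "(\<integral>\<^sup>+ s. \<integral>\<^sup>+ r. ennreal ((norm (F r))\<^sup>2 * k s r) \<partial>lborel \<partial>lborel) =
        (\<integral>\<^sup>+ r. \<integral>\<^sup>+ s. ennreal ((norm (F r))\<^sup>2 * k s r) \<partial>lborel \<partial>lborel)"
      by (rule lborel_pair.Fubini'[symmetric]) measurable
    also have "\<dots> = (\<integral>\<^sup>+ r. \<integral>\<^sup>+ s. ennreal ((norm (F r))\<^sup>2 * k r s) \<partial>lborel \<partial>lborel)"
      by (intro nn_integral_cong) (metis k_sym)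
    also have "\<dots> = ?c * ?N"
      by (rule one)
    finally show ?thesis .
  qed
  \<comment> \<open>The factor 2 stays on the left to match 2xy <= x^2 + y^2 and is cancelled at the
    end.\<close>
  have "2 * (\<integral>\<^sup>+ (s, r). ennreal (norm (F s) * norm (F r) * k s r) \<partial>(lborel \<Otimes>\<^sub>M lborel))
      = (\<integral>\<^sup>+ (s, r). ennreal (2 * (norm (F s) * norm (F r)) * k s r) \<partial>(lborel \<Otimes>\<^sub>M lborel))"
    by (subst nn_integral_cmult[symmetric])
      (auto intro!: nn_integral_cong simp: ennreal_mult' mult.assoc)
  also have "\<dots> = (\<integral>\<^sup>+ s. \<integral>\<^sup>+ r. ennreal (2 * (norm (F s) * norm (F r)) * k s r) \<partial>lborel \<partial>lborel)"
    by (subst lborel.nn_integral_fst[symmetric]) auto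
  also have "\<dots> \<le> (\<integral>\<^sup>+ s. \<integral>\<^sup>+ r. ennreal ((norm (F s))\<^sup>2 * k s r) + ennreal ((norm (F r))\<^sup>2 * k s r) \<partial>lborel \<partial>lborel)"
  proof (intro nn_integral_mono)
    fix s r
    have "2 * (norm (F s) * norm (F r)) * k s r \<le> ((norm (F s))\<^sup>2 + (norm (F r))\<^sup>2) * k s r"
      using sum_squares_bound[of "norm (F s)" "norm (F r)"] by (intro mult_right_mono k_nonneg) simp
    then have "ennreal (2 * (norm (F s) * norm (F r)) * k s r)
        \<le> ennreal ((norm (F s))\<^sup>2 * k s r + (norm (F r))\<^sup>2 * k s r)"
      by (intro ennreal_leI) (simp only: distrib_right)
    also have "\<dots> = ennreal ((norm (F s))\<^sup>2 * k s r) + ennreal ((norm (F r))\<^sup>2 * k s r)"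
      by (intro ennreal_plus mult_nonneg_nonneg k_nonneg) auto
    finally show "ennreal (2 * (norm (F s) * norm (F r)) * k s r)
        \<le> ennreal ((norm (F s))\<^sup>2 * k s r) + ennreal ((norm (F r))\<^sup>2 * k s r)" .
  qed
  also have "\<dots> = 2 * (?c * ?N)"
  proof -
    have "(\<integral>\<^sup>+ r. ennreal ((norm (F s))\<^sup>2 * k s r) + ennreal ((norm (F r))\<^sup>2 * k s r) \<partial>lborel) =
        (\<integral>\<^sup>+ r. ennreal ((norm (F s))\<^sup>2 * k s r) \<partial>lborel) + (\<integral>\<^sup>+ r. ennreal ((norm (F r))\<^sup>2 * k s r) \<partial>lborel)" for s
      by (rule nn_integral_add) measurable
    then show ?thesis
      by (simp only:) (subst nn_integral_add, measurable, simp only: one two mult_2[of "?c * ?N"])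
  qed
  finally have "2 * (\<integral>\<^sup>+ (s, r). ennreal (norm (F s) * norm (F r) * k s r) \<partial>(lborel \<Otimes>\<^sub>M lborel))
      \<le> 2 * (?c * ?N)" .
  then show ?thesis
    by (simp add: ennreal_mult_le_mult_iff k_def)
qed

text \<open>A weighted, one-sided form of Plancherel. The squared modulus is a double integral of
  F(s) cnj(F(r)) exp(i a (s - r) x); averaging over a standard normal x turns the exponential into
  the normal characteristic function, a Gaussian in s - r, to which Schur's test applies.\<close>

lemma nn_integral_inv_fourier_gaussian:
  assumes F: "band_limited \<gamma> F" and a: "0 < a"
  shows "(\<integral>\<^sup>+ x. ennreal ((norm (inv_fourier F (complex_of_real (a * x))))\<^sup>2) \<partial>std_normal_distribution)
      \<le> ennreal (sqrt (2 * pi) / a) * (\<integral>\<^sup>+ s. ennreal ((norm (F s))\<^sup>2) \<partial>lborel)"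
proof -
  note [measurable] = band_limited_measurable[OF F]
  have Fi: "integrable lborel F"
    by (rule band_limited_integrable[OF F])
  define K where "K = (\<lambda>p. F (fst p) * cnj (F (snd p)))"
  have K_meas [measurable]: "K \<in> borel_measurable (lborel \<Otimes>\<^sub>M lborel)"
    unfolding K_def by measurable
  have K_int: "integrable (lborel \<Otimes>\<^sub>M lborel) K"
  proof (rule lborel_pair.Fubini_integrable)
    show "integrable lborel (\<lambda>s. LINT r|lborel. norm (K (s, r)))"
      using Fi by (simp add: K_def norm_mult)
    show "AE s in lborel. integrable lborel (\<lambda>r. K (s, r))"
      using Fi by (simp add: K_def)
  qed measurable
  let ?N = "std_normal_distribution"
  let ?h = "\<lambda>x. inv_fourier F (complex_of_real (a * x))"
  let ?E = "\<lambda>x p. iexp ((a * (fst p - snd p)) * x)"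
  interpret N: real_distribution ?N
    by (rule real_dist_normal_dist)
  interpret P: pair_sigma_finite ?N "lborel \<Otimes>\<^sub>M (lborel :: real measure)"
    by (intro pair_sigma_finite.intro N.sigma_finite_measure_axioms sigma_finite_pair_measure
        sigma_finite_lborel)
  have KE_int: "integrable (lborel \<Otimes>\<^sub>M lborel) (\<lambda>p. K p * ?E x p)" for x
    by (rule Bochner_Integration.integrable_bound[OF K_int]) (auto simp: norm_mult)
  have h_sq: "complex_of_real ((norm (?h x))\<^sup>2) = (LINT p|(lborel \<Otimes>\<^sub>M lborel). K p * ?E x p)" for x
  proof -
    define Fe where "Fe = (\<lambda>s. F s * exp (\<i> * complex_of_real (a * x) * complex_of_real s))"
    have "complex_of_real ((norm (?h x))\<^sup>2) = ?h x * cnj (?h x)"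
      by (rule complex_norm_square)
    also have "\<dots> = (LINT s|lborel. LINT r|lborel. Fe s * cnj (Fe r))"
      unfolding inv_fourier_def Fe_def[symmetric] by simp
    also have "\<dots> = (LINT s|lborel. LINT r|lborel. K (s, r) * ?E x (s, r))"
    proof (intro Bochner_Integration.integral_cong refl)
      fix s r
      show "Fe s * cnj (Fe r) = K (s, r) * ?E x (s, r)"
        by (simp add: Fe_def K_def exp_cnj exp_minus exp_diff algebra_simps divide_inverse)
    qed
    also have "\<dots> = (LINT p|(lborel \<Otimes>\<^sub>M lborel). K p * ?E x p)"
      by (rule lborel_pair.integral_fst'[OF KE_int])
    finally show ?thesis .
  qed
  \<comment> \<open>\<open>iexp\<close> has modulus 1, so the integrand is dominated by |K|
    uniformly in x, and x ranges over a probability space.\<close>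
  have triple: "integrable (?N \<Otimes>\<^sub>M (lborel \<Otimes>\<^sub>M lborel)) (\<lambda>(x, p). K p * ?E x p)"
  proof (rule P.Fubini_integrable)
    show "integrable ?N (\<lambda>x. LINT p|(lborel \<Otimes>\<^sub>M lborel). norm (case (x, p) of (x, p) \<Rightarrow> K p * ?E x p))"
      by (simp add: norm_mult)
    show "AE x in ?N. integrable (lborel \<Otimes>\<^sub>M lborel) (\<lambda>p. case (x, p) of (x, p) \<Rightarrow> K p * ?E x p)"
      using KE_int by simp
    show "(\<lambda>(x, p). K p * ?E x p) \<in> borel_measurable (?N \<Otimes>\<^sub>M (lborel \<Otimes>\<^sub>M lborel))"
      by measurable
  qed
  have h_int: "integrable ?N (\<lambda>x. complex_of_real ((norm (?h x))\<^sup>2))"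
    unfolding h_sq using P.integrable_fst'[OF triple] by simp
  then have h_int': "integrable ?N (\<lambda>x. (norm (?h x))\<^sup>2)"
    by (simp add: complex_of_real_integrable_eq del: of_real_power)
  have ch: "(LINT x|?N. K p * ?E x p) = K p * complex_of_real (exp (- (a * (fst p - snd p))\<^sup>2 / 2))" for p
    using fun_cong[OF char_std_normal_distribution, of "a * (fst p - snd p)"]
    by (simp add: char_def)
  have "complex_of_real (LINT x|?N. (norm (?h x))\<^sup>2) =
      (LINT x|?N. LINT p|(lborel \<Otimes>\<^sub>M lborel). K p * ?E x p)"
    unfolding h_sq[symmetric] by (rule integral_complex_of_real[symmetric])
  also have "\<dots> = (LINT p|(lborel \<Otimes>\<^sub>M lborel). LINT x|?N. K p * ?E x p)"
    by (rule P.Fubini_integral[symmetric, OF triple])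
  also have "\<dots> = (LINT p|(lborel \<Otimes>\<^sub>M lborel). K p * complex_of_real (exp (- (a * (fst p - snd p))\<^sup>2 / 2)))"
    unfolding ch ..
  finally have eq: "complex_of_real (LINT x|?N. (norm (?h x))\<^sup>2) =
     (LINT p|(lborel \<Otimes>\<^sub>M lborel). K p * complex_of_real (exp (- (a * (fst p - snd p))\<^sup>2 / 2)))" .
  \<comment> \<open>The weighted integral is real and nonnegative, hence at most its own modulus,
    and the modulus may be taken inside the double integral.\<close>
  have "(\<integral>\<^sup>+ x. ennreal ((norm (?h x))\<^sup>2) \<partial>?N) = ennreal (LINT x|?N. (norm (?h x))\<^sup>2)"
    by (rule nn_integral_eq_integral[OF h_int']) simp
  also have "\<dots> \<le> ennreal (norm (complex_of_real (LINT x|?N. (norm (?h x))\<^sup>2)))"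
    by (intro ennreal_leI) simp
  also have "\<dots> \<le> (\<integral>\<^sup>+ p. norm (K p * complex_of_real (exp (- (a * (fst p - snd p))\<^sup>2 / 2))) \<partial>(lborel \<Otimes>\<^sub>M lborel))"
    unfolding eq
  proof (rule integral_norm_bound_ennreal)
    show "integrable (lborel \<Otimes>\<^sub>M lborel) (\<lambda>p. K p * complex_of_real (exp (- (a * (fst p - snd p))\<^sup>2 / 2)))"
      unfolding ch[symmetric] using P.integrable_snd[OF triple] .
  qed
  also have "\<dots> = (\<integral>\<^sup>+ (s, r). ennreal (norm (F s) * norm (F r) * exp (- (a * (s - r))\<^sup>2 / 2)) \<partial>(lborel \<Otimes>\<^sub>M lborel))"
    by (intro nn_integral_cong) (auto simp: K_def norm_mult)
  also have "\<dots> \<le> ennreal (sqrt (2 * pi) / a) * (\<integral>\<^sup>+ s. ennreal ((norm (F s))\<^sup>2) \<partial>lborel)"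
    by (rule nn_integral_schur_gaussian[OF _ a]) measurable
  finally show ?thesis .
qed

text \<open>
  Without this \<open>L2norm_sq f\<close> could be \<open>0\<close> merely because the Bochner integral of a non-integrable
  function is \<open>0\<close>. Weighting \<open>|f|\<^sup>2\<close> by a wide Gaussian gives a bound independent of its width.
\<close>

lemma PW_square_integrable:
  assumes f: "f \<in> PW \<gamma>"
  shows "integrable lborel (\<lambda>x. (norm (f (complex_of_real x)))\<^sup>2)"
proof -
  obtain F where F: "band_limited \<gamma> F" "f = inv_fourier F"
    using f by (auto simp: PW_iff)
  have "continuous_on UNIV f"
    using PW_holomorphic[OF f] holomorphic_on_imp_continuous_on by blast
  then have [measurable]: "f \<in> borel_measurable borel"
    by (rule borel_measurable_continuous_onI)
  let ?h = "\<lambda>x. (norm (f (complex_of_real x)))\<^sup>2"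
  let ?N = "\<integral>\<^sup>+ s. ennreal ((norm (F s))\<^sup>2) \<partial>lborel"
  have bound: "(\<integral>\<^sup>+ x. ennreal (exp (- (x / a)\<^sup>2 / 2) * ?h x) \<partial>lborel) \<le> ennreal (2 * pi) * ?N"
    if a: "0 < a" for a
  proof -
    \<comment> \<open>Substituting a x for x produces a factor a, which cancels the 1/a of the
      Gaussian estimate. One sqrt (2 pi) normalises the density, the other comes from that
      estimate.\<close>
    have "(\<integral>\<^sup>+ x. ennreal (exp (- (x / a)\<^sup>2 / 2) * ?h x) \<partial>lborel) =
        ennreal a * (\<integral>\<^sup>+ x. ennreal (exp (- x\<^sup>2 / 2) * ?h (a * x)) \<partial>lborel)"
      using a by (subst nn_integral_real_affine[of _ a 0]) (auto simp: abs_of_pos)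
    also have "(\<integral>\<^sup>+ x. ennreal (exp (- x\<^sup>2 / 2) * ?h (a * x)) \<partial>lborel) =
        (\<integral>\<^sup>+ x. ennreal (sqrt (2 * pi)) * (ennreal (std_normal_density x) * ennreal (?h (a * x))) \<partial>lborel)"
      by (intro nn_integral_cong) (simp add: std_normal_density_def ennreal_mult'[symmetric])
    also have "\<dots> = ennreal (sqrt (2 * pi)) * (\<integral>\<^sup>+ x. ennreal (?h (a * x)) \<partial>std_normal_distribution)"
      by (simp add: nn_integral_cmult nn_integral_density)
    also have "ennreal a * \<dots> \<le> ennreal a * (ennreal (sqrt (2 * pi)) * (ennreal (sqrt (2 * pi) / a) * ?N))"
      unfolding F(2) by (intro mult_left_mono nn_integral_inv_fourier_gaussian[OF F(1) a]) auto
    also have "\<dots> = ennreal (2 * pi) * ?N"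
      using a by (simp add: mult.assoc[symmetric] ennreal_mult'[symmetric])
    finally show ?thesis .
  qed
  \<comment> \<open>The Gaussian weights of width n + 1 tend to 1 pointwise, so Fatou's lemma
    transfers the uniform bound to the unweighted integral.\<close>
  have "(\<integral>\<^sup>+ x. ennreal (?h x) \<partial>lborel) =
      (\<integral>\<^sup>+ x. liminf (\<lambda>n. ennreal (exp (- (x / real (Suc n))\<^sup>2 / 2) * ?h x)) \<partial>lborel)"
  proof (intro nn_integral_cong)
    fix x
    have "(\<lambda>n. x / real (Suc n)) \<longlonglongrightarrow> 0"
      using LIMSEQ_inverse_real_of_nat[THEN tendsto_mult_right_zero, of x] by (simp add: divide_inverse)
    then have "(\<lambda>n. exp (- (x / real (Suc n))\<^sup>2 / 2) * ?h x) \<longlonglongrightarrow> exp (- (0\<^sup>2) / 2) * ?h x"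
      by (intro tendsto_intros) auto
    then have "(\<lambda>n. ennreal (exp (- (x / real (Suc n))\<^sup>2 / 2) * ?h x)) \<longlonglongrightarrow> ennreal (?h x)"
      by (intro tendsto_ennrealI) simp
    then show "ennreal (?h x) = liminf (\<lambda>n. ennreal (exp (- (x / real (Suc n))\<^sup>2 / 2) * ?h x))"
      by (intro lim_imp_Liminf[symmetric]) auto
  qed
  also have "\<dots> \<le> liminf (\<lambda>n. \<integral>\<^sup>+ x. ennreal (exp (- (x / real (Suc n))\<^sup>2 / 2) * ?h x) \<partial>lborel)"
    by (rule nn_integral_liminf) measurable
  also have "\<dots> \<le> liminf (\<lambda>n::nat. ennreal (2 * pi) * ?N)"
    by (intro Liminf_mono always_eventually allI bound) auto
  also have "\<dots> < \<infinity>"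
    using F(1) by (auto simp: band_limited_def Liminf_const integrable_iff_bounded ennreal_mult_less_top)
  finally show ?thesis
    by (intro integrableI_bounded) auto
qed

section \<open>Sampling sets are sets of uniqueness\<close>

text \<open>The set where h is nonzero is open and null, and a nonempty open set is not
  negligible.\<close>

lemma continuous_AE_zero_imp_zero:
  fixes h :: "real \<Rightarrow> 'a::real_normed_vector"
  assumes cont: "continuous_on UNIV h" and ae: "AE x in lborel. h x = 0"
  shows "h x = 0"
proof (rule ccontr)
  assume "h x \<noteq> 0"
  let ?S = "{x. h x \<noteq> 0}"
  have "open ?S"
    using open_Collect_neq[OF cont continuous_on_const] by simp
  moreover have "?S \<in> null_sets lborel"
    using ae \<open>open ?S\<close> by (subst AE_iff_null_sets) auto
  then have "negligible ?S"
    by (simp add: negligible_iff_null_sets null_sets_completionI)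
  ultimately show False
    using open_not_negligible[of ?S] \<open>h x \<noteq> 0\<close> by blast
qed

lemma entire_zero_on_reals_imp_zero:
  assumes "h holomorphic_on UNIV" "\<And>x. h (complex_of_real x) = 0"
  shows "h z = 0"
proof (rule analytic_continuation[of h UNIV "range complex_of_real" 0])
  show "0 islimpt range complex_of_real"
    unfolding islimpt_approachable
  proof (intro allI impI)
    fix e :: real assume "0 < e"
    then show "\<exists>x'\<in>range complex_of_real. x' \<noteq> 0 \<and> dist x' 0 < e"
      by (intro bexI[of _ "complex_of_real (e / 2)"] rangeI) auto
  qed
qed (use assms in auto)

text \<open>The lower sampling inequality forces the norm to be 0. Square integrability turns this
  into vanishing almost everywhere on the line, continuity into vanishing on all of it, and the
  identity theorem into vanishing on the plane.\<close>

lemma sampling_set_uniqueness: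
  assumes "sampling_set t \<gamma>" and h: "h \<in> PW \<gamma>" and zero: "\<And>n. h (complex_of_real (t n)) = 0"
  shows "h z = 0"
proof -
  obtain A where A: "0 < A" "A * L2norm_sq h \<le> (\<Sum>\<^sub>\<infinity>n. (norm (h (complex_of_real (t n))))\<^sup>2)"
    using assms(1) h unfolding sampling_set_def by blast
  then have "L2norm_sq h \<le> 0"
    by (simp add: zero mult_le_0_iff)
  moreover have "0 \<le> L2norm_sq h"
    unfolding L2norm_sq_def by simp
  ultimately have "L2norm_sq h = 0" by simp
  then have ae: "AE x in lborel. h (complex_of_real x) = 0"
    unfolding L2norm_sq_def using integral_nonneg_eq_0_iff_AE[OF PW_square_integrable[OF h]] by simp
  have hol: "h holomorphic_on UNIV"
    by (rule PW_holomorphic[OF h])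
  have "continuous_on UNIV (\<lambda>x. h (complex_of_real x))"
    by (intro continuous_on_compose2[OF holomorphic_on_imp_continuous_on[OF hol]] continuous_intros) auto
  then have "h (complex_of_real x) = 0" for x
    using continuous_AE_zero_imp_zero ae by blast
  then show ?thesis
    using entire_zero_on_reals_imp_zero[OF hol] by blast
qed

section \<open>Zero divisors and Wronskians of entire functions\<close>

text \<open>If g is nonzero somewhere, it is nonzero on a nonempty open set; f vanishes there, hence
  everywhere by analytic continuation.\<close>

lemma entire_mult_eq_0_imp:
  assumes f: "f holomorphic_on UNIV" and g: "g holomorphic_on UNIV" and fg: "\<And>z. f z * g z = 0"
  shows "(\<forall>z. f z = 0) \<or> (\<forall>z. g z = (0::complex))"
proof (rule disjCI)
  assume "\<not> (\<forall>z. g z = 0)"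
  then have ne: "{z. g z \<noteq> 0} \<noteq> {}" by blast
  have "open {z. g z \<noteq> 0}"
    using open_Collect_neq[OF holomorphic_on_imp_continuous_on[OF g] continuous_on_const] by simp
  then have "f z = 0" for z
    by (rule analytic_continuation_open[of "{z. g z \<noteq> 0}" UNIV f "\<lambda>_. 0"]) (use ne f fg in auto)
  then show "\<forall>z. f z = 0" by blast
qed

text \<open>Near \<open>z0\<close> the quotient f/g has derivative 0 and is constant. Analytic
  continuation then carries the identity past the zeros of g.\<close>

lemma entire_wronskian_eq_0_imp_proportional:
  assumes f: "f holomorphic_on UNIV" and g: "g holomorphic_on UNIV"
    and w: "\<And>z. deriv f z * g z = deriv g z * f z" and z0: "g z0 \<noteq> 0"
  obtains c where "\<And>z. f z = c * g z"
proof -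
  have "open {z. g z \<noteq> 0}"
    using open_Collect_neq[OF holomorphic_on_imp_continuous_on[OF g] continuous_on_const] by simp
  then obtain r where r: "0 < r" "ball z0 r \<subseteq> {z. g z \<noteq> 0}"
    using z0 open_contains_ball by blast
  have "((\<lambda>z. f z / g z) has_field_derivative 0) (at z within ball z0 r)" if "z \<in> ball z0 r" for z
  proof -
    have "g z \<noteq> 0" using r that by blast
    have "(f has_field_derivative deriv f z) (at z)" "(g has_field_derivative deriv g z) (at z)"
      using f g by (auto intro!: holomorphic_derivI)
    then have "((\<lambda>z. f z / g z) has_field_derivative (deriv f z * g z - f z * deriv g z) / (g z * g z)) (at z)"
      using \<open>g z \<noteq> 0\<close> by (rule DERIV_divide)
    moreover have "deriv f z * g z - f z * deriv g z = 0"
      using w[of z] by (simp only: mult.commute[of "f z"]) simp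
    ultimately show ?thesis
      by (simp add: has_field_derivative_at_within)
  qed
  then have "\<exists>c. \<forall>z\<in>ball z0 r. f z / g z = c"
    by (rule has_field_derivative_zero_constant[OF convex_ball])
  then obtain c where c: "\<And>z. z \<in> ball z0 r \<Longrightarrow> f z / g z = c" by blast
  have "f z = c * g z" for z
  proof (rule analytic_continuation_open[of "ball z0 r" UNIV f "\<lambda>z. c * g z"])
    show "f z = c * g z" if "z \<in> ball z0 r" for z
      using c[OF that] r that by (auto simp: field_simps)
  qed (use r f g in \<open>auto intro!: holomorphic_intros\<close>)
  then show ?thesis using that by blast
qed

section \<open>The reflected function and moduli on the sampling set\<close>

lemma sharp_of_real: "sharp f (complex_of_real x) = cnj (f (complex_of_real x))"
  by (simp add: sharp_def)

lemma sharp_sharp [simp]: "sharp (sharp f) = f"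
  by (simp add: sharp_def)

lemma deriv_sharp:
  assumes "f holomorphic_on UNIV"
  shows "deriv (sharp f) = sharp (deriv f)"
proof
  fix z
  have "(f has_field_derivative deriv f (cnj z)) (at (cnj z))"
    using assms by (auto intro!: holomorphic_derivI)
  then show "deriv (sharp f) z = sharp (deriv f) z"
    unfolding sharp_def
    by (intro DERIV_imp_deriv) (rule has_field_derivative_cnj_cnj[unfolded o_def])
qed

text \<open>Multiplying by the reflected function doubles the band, hence sampling at
  \<open>2 * \<gamma>\<close>. On the real line the difference of the two products is |f|^2 -
  |g|^2.\<close>

lemma PW_modulus_eq_on_sampling_set:
  assumes t: "sampling_set t (2 * \<gamma>)" and f: "f \<in> PW \<gamma>" and g: "g \<in> PW \<gamma>"
    and eq: "\<And>n. norm (f (complex_of_real (t n))) = norm (g (complex_of_real (t n)))"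
  shows "f z * sharp f z = g z * sharp g z"
proof -
  define h where "h = (\<lambda>z. f z * sharp f z - g z * sharp g z)"
  have "h \<in> PW (\<gamma> + \<gamma>)"
    unfolding h_def using f g by (intro PW_diff PW_mult PW_sharp)
  then have h: "h \<in> PW (2 * \<gamma>)"
    by (simp only: mult_2)
  have "h (complex_of_real (t n)) = 0" for n
    using eq[of n] by (simp add: h_def sharp_of_real complex_norm_square[symmetric])
  then have "h z = 0"
    by (rule sampling_set_uniqueness[OF t h])
  then show ?thesis by (simp add: h_def)
qed

text \<open>Here \<open>f'\<close> and \<open>g'\<close> are partner functions, not derivatives:
  \<open>f'\<close> will be \<open>sharp f\<close>, and \<open>g'\<close> will be
  \<open>sharp g\<close> or \<open>g\<close>. Dividing the second relation by the first says that f
  and g have the same logarithmic derivative.\<close>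

lemma entire_proportional_if_log_derivs_match:
  assumes f: "f holomorphic_on UNIV" "f' holomorphic_on UNIV" and g: "g holomorphic_on UNIV"
    and ff: "\<And>z. f z * f' z = g z * g' z"
    and df: "\<And>z. deriv f z * f' z = deriv g z * g' z"
    and z0: "f z0 * f' z0 \<noteq> 0"
  obtains c where "\<And>z. f z = c * g z"
proof -
  have "(deriv f z * g z - deriv g z * f z) * (f z * f' z) = 0" for z
  proof -
    \<comment> \<open>The Wronskian is multiplied by \<open>f z * f' z\<close> so that both
      relations can be substituted without division.\<close>
    have "(deriv f z * g z - deriv g z * f z) * (f z * f' z) =
        (deriv f z * f' z) * (f z * g z) - deriv g z * f z * (f z * f' z)"
      by (simp add: algebra_simps)
    also have "\<dots> = 0"
      unfolding df ff by (simp add: algebra_simps)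
    finally show ?thesis .
  qed
  then have "(\<forall>z. deriv f z * g z - deriv g z * f z = 0) \<or> (\<forall>z. f z * f' z = 0)"
    using f g by (intro entire_mult_eq_0_imp) (auto intro!: holomorphic_intros holomorphic_deriv)
  then have "\<And>z. deriv f z * g z = deriv g z * f z"
    using z0 by auto
  moreover have "g z0 \<noteq> 0"
    using z0 ff[of z0] by auto
  ultimately show ?thesis
    using entire_wronskian_eq_0_imp_proportional[OF f(1) g] that by blast
qed

text \<open>Reflection conjugates the constant, so the product for f is |c|^2 times the product for
  g; the two are compared at a point where the latter is nonzero.\<close>

lemma norm_eq_1_if_mult_sharp_eq:
  assumes "\<And>z. f z = c * g z" "\<And>z. f z * sharp f z = g z * sharp g z" "g z0 * sharp g z0 \<noteq> 0"
  shows "norm c = 1"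
proof -
  have "(c * cnj c) * (g z0 * sharp g z0) = g z0 * sharp g z0"
    using assms(1)[of z0] assms(1)[of "cnj z0"] assms(2)[of z0] by (simp add: sharp_def mult_ac)
  then have "c * cnj c = 1"
    using assms(3) by simp
  then have "complex_of_real ((norm c)\<^sup>2) = 1"
    by (simp only: complex_norm_square)
  then show ?thesis
    by (simp only: of_real_eq_1_iff) (simp add: power2_eq_1_iff, use norm_ge_zero[of c] in linarith)
qed

section \<open>Recovery of the function up to a unimodular constant and reflection\<close>

theorem theorem2p10:
  fixes t :: "int \<Rightarrow> real" and f g :: "complex \<Rightarrow> complex"
  assumes "sampling_set t (2 * pi)"
    and "f \<in> PW pi" and "g \<in> PW pi"
    and "\<And>n. norm (f (complex_of_real (t n))) = norm (g (complex_of_real (t n)))"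
    and "\<And>n. norm (deriv f (complex_of_real (t n))) = norm (deriv g (complex_of_real (t n)))"
  shows "\<exists>c::complex. norm c = 1 \<and> (f = (\<lambda>z. c * g z) \<or> f = (\<lambda>z. c * sharp g z))"
proof -
  have hol: "f holomorphic_on UNIV" "g holomorphic_on UNIV"
    "sharp f holomorphic_on UNIV" "sharp g holomorphic_on UNIV"
    using assms PW_holomorphic PW_sharp by blast+
  have e0: "f z * sharp f z = g z * sharp g z" for z
    using PW_modulus_eq_on_sampling_set assms by blast
  have e1: "deriv f z * deriv (sharp f) z = deriv g z * deriv (sharp g) z" for z
    using PW_modulus_eq_on_sampling_set[OF assms(1) PW_deriv[OF assms(2)] PW_deriv[OF assms(3)] assms(5)]
    by (simp add: deriv_sharp hol)
  have sum: "deriv f z * sharp f z + f z * deriv (sharp f) z = deriv g z * sharp g z + g z * deriv (sharp g) z" for z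
  proof -
    have prod: "deriv (\<lambda>z. u z * sharp u z) z = deriv u z * sharp u z + u z * deriv (sharp u) z"
      if "u holomorphic_on UNIV" "sharp u holomorphic_on UNIV" for u
      using that by (subst complex_derivative_mult_at)
        (auto simp: analytic_on_open[of UNIV] intro: analytic_on_subset[of _ UNIV])
    show ?thesis
      using prod[of f] prod[of g] hol by (simp add: e0)
  qed
  have "(deriv f z * sharp f z - deriv g z * sharp g z) * (deriv f z * sharp f z - g z * deriv (sharp g) z) = 0" for z
  proof -
    \<comment> \<open>Two pairs with equal sum and equal product are roots of the same quadratic:
      a^2 - (p + q) a + p q = a^2 - (a + b) a + a b = 0.\<close>
    define a b p q where "a = deriv f z * sharp f z" and "b = f z * deriv (sharp f) z"
      and "p = deriv g z * sharp g z" and "q = g z * deriv (sharp g) z"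
    have "a * b = (deriv f z * deriv (sharp f) z) * (f z * sharp f z)"
      by (simp add: a_def b_def)
    also have "\<dots> = p * q"
      unfolding e0 e1 by (simp add: p_def q_def)
    finally have "a * b = p * q" .
    moreover have "a + b = p + q"
      using sum[of z] by (simp add: a_def b_def p_def q_def)
    ultimately have "(a - p) * (a - q) = 0"
      by algebra
    then show ?thesis by (simp add: a_def p_def q_def)
  qed
  then have "(\<forall>z. deriv f z * sharp f z - deriv g z * sharp g z = 0) \<or>
      (\<forall>z. deriv f z * sharp f z - g z * deriv (sharp g) z = 0)"
    using hol by (intro entire_mult_eq_0_imp) (auto intro!: holomorphic_intros holomorphic_deriv)
  \<comment> \<open>The second alternative is rearranged to be the first with \<open>g\<close> and
    \<open>sharp g\<close> exchanged, so one lemma serves both.\<close>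
  then have cases: "(\<forall>z. deriv f z * sharp f z = deriv g z * sharp g z) \<or>
      (\<forall>z. deriv f z * sharp f z = deriv (sharp g) z * g z)"
    by (auto simp: mult.commute)
  have zero: "u = (\<lambda>_. 0)" if "\<forall>z. u z * sharp u z = 0" "u holomorphic_on UNIV" "sharp u holomorphic_on UNIV" for u
  proof -
    have "(\<forall>z. u z = 0) \<or> (\<forall>z. sharp u z = 0)"
      using that by (intro entire_mult_eq_0_imp) auto
    then show ?thesis
      unfolding sharp_def by (metis complex_cnj_cnj complex_cnj_zero)
  qed
  show ?thesis
  proof (cases "\<forall>z. f z * sharp f z = 0")
    \<comment> \<open>Both functions vanish identically, so any unimodular constant serves; 1 is
      taken.\<close>
    case True
    then have "f = (\<lambda>_. 0)" "g = (\<lambda>_. 0)"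
      using zero[of f] zero[of g] hol e0 by auto
    then show ?thesis by (intro exI[of _ 1]) simp
  next
    case False
    then obtain z0 where z0: "f z0 * sharp f z0 \<noteq> 0" by blast
    from cases show ?thesis
    proof
      assume "\<forall>z. deriv f z * sharp f z = deriv g z * sharp g z"
      then obtain c where c: "\<And>z. f z = c * g z"
        using entire_proportional_if_log_derivs_match[OF hol(1,3,2) e0 _ z0] by blast
      moreover have "norm c = 1"
        using norm_eq_1_if_mult_sharp_eq[OF c e0] z0 e0 by metis
      ultimately show ?thesis by blast
    next
      assume "\<forall>z. deriv f z * sharp f z = deriv (sharp g) z * g z"
      moreover have e0': "f z * sharp f z = sharp g z * g z" for z
        using e0 by (simp add: mult.commute)
      ultimately obtain c where c: "\<And>z. f z = c * sharp g z"
        using entire_proportional_if_log_derivs_match[OF hol(1,3,4) e0' _ z0] by blast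
      moreover have "norm c = 1"
        \<comment> \<open>With \<open>sharp g\<close> in the role of \<open>g\<close>, its
          reflection is \<open>g\<close> again, so \<open>e0'\<close> is the product identity
          required.\<close>
        using norm_eq_1_if_mult_sharp_eq[of f c "sharp g", OF c] z0 e0' unfolding sharp_sharp by metis
      ultimately show ?thesis by blast
    qed
  qed
qed

end
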